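(* Let $q$ be an odd prime power with $q\equiv-1\pmod 4$ and $\ell>1$ an odd integer. Let $\omega\in\mathbb{F}_{q^2}\setminus\mathbb{F}_q$ with $\omega^q=-\omega$, put $\sigma=\omega^2$, and let $\bar\beta\in\mathbb{F}_{q^2}$ with $\bar\beta^{q+1}=\sigma^{-1}$. Then the commutative presemifields $P(q,\ell)$ and $\overline{B}(q,\ell,2,\bar\beta)$ are not strongly isotopic.
   Context: Write $\ell=2k+1$. $P(q,\ell)=(\mathbb{F}_{q^{2\ell}},+,* )$ with $x*y=\tfrac12(xy+x^{q^\ell}y^{q^\ell})+\tfrac14G(xy^{q^2}+x^{q^2}y)$, where $G(x)=\sum_{i=1}^{k}(-1)^i(x-x^{q^\ell})^{q^{2i}}+\sum_{j=1}^{k-1}(-1)^{k+j}(x-x^{q^\ell})^{q^{2j+1}}$. $\overline{B}(q,\ell,2,\bar\beta)=(\mathbb{F}_{q^{2\ell}},+,\star)$ with $x\star y=xy^{q^\ell}+x^{q^\ell}y+[\bar\beta(xy^{q^2}+x^{q^2}y)+\bar\beta^{q^\ell}(xy^{q^2}+x^{q^2}y)^{q^\ell}]\omega$. Two presemifields $(\mathbb{F},+,\bullet)$, $(\mathbb{F},+,\star)$ of characteristic $p$ are strongly isotopic if there exist $\mathbb{F}_p$-linear permutations $M,L$ of $\mathbb{F}$ with $M(x)\star M(y)=L(x\bullet y)$ for all $x,y$. *)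

theory Defs
  imports
    "HOL-Library.Cardinality"
    "HOL-Number_Theory.Number_Theory"
    "HOL-Number_Theory.Prime_Powers"
begin

text \<open>
  The field with \<open>q ^ (2 * l)\<close> elements is a type \<open>'a :: {field, finite}\<close> with
  \<open>CARD('a) = q ^ (2 * l)\<close>.  All presemifields below live on the additive group of this
  field, so a presemifield is represented by its multiplication \<open>'a \<Rightarrow> 'a \<Rightarrow> 'a\<close>.
\<close>

text \<open>
  A finite field has at most one subfield with \<open>r\<close> elements, and if it has one, it is the set
  of roots of \<open>X ^ r - X\<close>.  Below, \<open>r\<close> is \<open>q\<close> or \<open>q ^ 2\<close>, both of which are orders of subfields
  of the field with \<open>q ^ (2 * l)\<close> elements.
\<close>

definition subfield_of_order :: "nat \<Rightarrow> 'a :: {field, finite} set" where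
  "subfield_of_order r = {x. x ^ r = x}"

text \<open>
  The prime field of \<open>'a\<close> is \<open>range of_nat\<close>, as the characteristic is positive.
\<close>

definition prime_field_linear :: "('a :: {field, finite} \<Rightarrow> 'a) \<Rightarrow> bool" where
  "prime_field_linear f \<longleftrightarrow>
     (\<forall>x y. f (x + y) = f x + f y) \<and>
     (\<forall>c \<in> range of_nat. \<forall>x. f (c * x) = c * f x)"

definition strongly_isotopic ::
  "('a :: {field, finite} \<Rightarrow> 'a \<Rightarrow> 'a) \<Rightarrow> ('a \<Rightarrow> 'a \<Rightarrow> 'a) \<Rightarrow> bool" where
  "strongly_isotopic f g \<longleftrightarrow>
     (\<exists>M L. prime_field_linear M \<and> bij M \<and> prime_field_linear L \<and> bij L \<and>
            (\<forall>x y. g (M x) (M y) = L (f x y)))"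

text \<open>
  In the next two definitions \<open>l = 2 * k + 1\<close>, so \<open>k = l div 2\<close>.  The second sum is empty
  when \<open>k = 1\<close>.
\<close>

definition G_fun :: "nat \<Rightarrow> nat \<Rightarrow> 'a :: {field, finite} \<Rightarrow> 'a" where
  "G_fun q l x = (let k = l div 2 in
     (\<Sum>i = 1..k. (-1) ^ i * (x - x ^ (q ^ l)) ^ (q ^ (2 * i))) +
     (\<Sum>j = 1..k - 1. (-1) ^ (k + j) * (x - x ^ (q ^ l)) ^ (q ^ (2 * j + 1))))"

definition P_mult :: "nat \<Rightarrow> nat \<Rightarrow> 'a :: {field, finite} \<Rightarrow> 'a \<Rightarrow> 'a" where
  "P_mult q l x y =
     (1 / 2) * (x * y + x ^ (q ^ l) * y ^ (q ^ l)) +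
     (1 / 4) * G_fun q l (x * y ^ (q ^ 2) + x ^ (q ^ 2) * y)"

text \<open>
  \<open>\<omega>\<close> is an explicit parameter.  The multiplication is that of \<open>B(q, l, d, \<beta>)\<close> for \<open>d = 2\<close>.
\<close>

definition B2_mult ::
  "nat \<Rightarrow> nat \<Rightarrow> 'a \<Rightarrow> 'a \<Rightarrow> 'a :: {field, finite} \<Rightarrow> 'a \<Rightarrow> 'a" where
  "B2_mult q l \<omega> \<beta> x y =
     x * y ^ (q ^ l) + x ^ (q ^ l) * y +
     (\<beta> * (x * y ^ (q ^ 2) + x ^ (q ^ 2) * y) +
      \<beta> ^ (q ^ l) * (x * y ^ (q ^ 2) + x ^ (q ^ 2) * y) ^ (q ^ l)) * \<omega>"

end

theory Submission
  imports Defs "HOL-Computational_Algebra.Polynomial"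
begin

text \<open>
  Let \<open>bar x = x ^ (q ^ l)\<close>.  Adding to \<open>M x \<star> M y = L (x * y)\<close> its image under \<open>bar\<close> removes the
  \<open>\<omega>\<close>-part and leaves
  \<open>M x * bar (M y) + bar (M x) * M y = A (x * y) + H (x * y ^ q\<^sup>2) + H (x ^ q\<^sup>2 * y)\<close> (products in the
  field) with additive \<open>A\<close>, \<open>H\<close> and \<open>bar \<circ> A = A = A \<circ> bar\<close>.  Choose \<open>a = p ^ i\<close> such that the coefficient
  \<open>U\<close> of \<open>x ^ a\<close> in the linearized polynomial of \<open>M\<close> is nonzero, and let \<open>V\<close> be that of \<open>bar \<circ> M\<close>.
  Comparing coefficients of \<open>x ^ a * y ^ a\<close> shows that \<open>bar\<close> fixes \<open>U * V\<close>; comparing those of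
  \<open>x ^ a * bar (y ^ a)\<close>, which do not occur on the right, gives \<open>U * bar U + V * bar V = 0\<close>.  Hence
  \<open>(U * V)\<^sup>2 = - (U * bar U)\<^sup>2\<close>, so \<open>-1\<close> is a square in the field of order \<open>q ^ l\<close>, although
  \<open>q ^ l\<close> is \<open>3\<close> modulo \<open>4\<close>.  Up to sign, the coefficients are extracted as character sums
  \<open>\<Sum>x \<noteq> 0. f x / x ^ a\<close>.
\<close>

section \<open>Powers and the prime field of a finite field\<close>

lemma finite_field_power_card:
  fixes x :: "'a :: {field, finite}"
  shows "x ^ CARD('a) = x"
proof (cases "x = 0")
  case False
  have "bij_betw ((*) x) (- {0}) (- {0})"
    by (rule bij_betw_byWitness[where f' = "\<lambda>y. y / x"]) (use False in auto)
  then have "(\<Prod>y\<in>-{0}. x * y) = (\<Prod>y\<in>-{0::'a}. y)"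
    by (rule prod.reindex_bij_betw)
  then have "x ^ card (- {0::'a}) = 1"
    by (simp add: prod.distrib)
  then show ?thesis
    by (metis Compl_eq_Diff_UNIV UNIV_I card.remove finite mult.right_neutral power_Suc)
qed simp

lemma finite_field_CHAR:
  assumes "prime p" and "CARD('a :: {field, finite}) = p ^ n"
  shows "CHAR('a) = p"
proof -
  have "prime CHAR('a)"
    by (simp add: finite_imp_CHAR_pos prime_CHAR_semidom)
  moreover have "CHAR('a) dvd p ^ n"
    using CHAR_dvd_CARD[where 'a = 'a] assms(2) by simp
  ultimately show ?thesis
    using assms(1) prime_dvd_power primes_dvd_imp_eq by blast
qed

text \<open>The nonzero polynomial \<open>X ^ t - X ^ s\<close> has too small a degree to vanish on
  the whole field.\<close>

lemma ex_power_neq: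
  assumes "s < t" and "t < CARD('a :: {field, finite})"
  shows "\<exists>x :: 'a. x ^ s \<noteq> x ^ t"
proof (rule ccontr)
  assume *: "\<nexists>x :: 'a. x ^ s \<noteq> x ^ t"
  define P :: "'a poly" where "P = monom 1 t - monom 1 s"
  have "coeff P t = 1"
    using assms(1) by (simp add: P_def)
  then have "P \<noteq> 0"
    by auto
  then have "card {x. poly P x = 0} \<le> degree P"
    by (rule card_poly_roots_bound)
  also have "{x. poly P x = 0} = UNIV"
    using * by (auto simp: P_def poly_monom)
  also have "degree P \<le> t"
    unfolding P_def using assms(1)
    by (intro degree_diff_le order.trans[OF degree_monom_le]) auto
  finally show False
    using assms(2) by simp
qed

text \<open>\<open>X ^ p - X\<close> has at most \<open>p\<close> roots, and the images of the
  numbers below \<open>p\<close> already supply \<open>p\<close> of them.\<close>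

lemma fixed_power_CHAR:
  fixes x :: "'a :: {field, finite}"
  assumes "x ^ CHAR('a) = x"
  shows "x \<in> range of_nat"
proof -
  define p where "p = CHAR('a)"
  have p: "prime p"
    by (simp add: p_def finite_imp_CHAR_pos prime_CHAR_semidom)
  then have p1: "1 < p"
    by (rule prime_gt_1_nat)
  define P :: "'a poly" where "P = monom 1 p - monom 1 1"
  define S :: "'a set" where "S = of_nat ` {..<p}"
  have "coeff P p = 1"
    using p1 by (simp add: P_def)
  then have "P \<noteq> 0"
    by auto
  have "inj_on (of_nat :: nat \<Rightarrow> 'a) {..<p}"
    by (auto simp: inj_on_def of_nat_eq_iff_cong_CHAR cong_def p_def)
  then have card_S: "card S = p"
    by (simp add: S_def card_image)
  have "(of_nat m :: 'a) ^ p = of_nat m" for m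
    using p by (induction m) (simp_all add: freshmans_dream p_def prime_gt_0_nat power_0_left)
  then have "S \<subseteq> {x. poly P x = 0}"
    by (auto simp: S_def P_def poly_monom)
  moreover have "card {x. poly P x = 0} \<le> p"
  proof -
    have "card {x. poly P x = 0} \<le> degree P"
      using \<open>P \<noteq> 0\<close> by (rule card_poly_roots_bound)
    also have "degree P \<le> p"
      unfolding P_def using p1
      by (intro degree_diff_le order.trans[OF degree_monom_le]) auto
    finally show ?thesis .
  qed
  ultimately have "S = {x. poly P x = 0}"
    by (intro card_seteq) (auto simp: card_S)
  moreover have "poly P x = 0"
    using assms by (simp add: P_def poly_monom p_def)
  ultimately show ?thesis
    by (auto simp: S_def)
qed

section \<open>Character sums over the nonzero elements\<close>

lemma sum_power_quotient_eq_0: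
  fixes g :: "'a :: {field, finite}"
  assumes "g \<noteq> 0" and "g ^ s \<noteq> g ^ t"
  shows "(\<Sum>x\<in>-{0::'a}. x ^ s / x ^ t) = 0"
proof -
  \<comment> \<open>Substituting \<open>g * x\<close> for \<open>x\<close> scales the sum by
    \<open>g ^ s / g ^ t\<close>, which is not 1.\<close>
  have "bij_betw ((*) g) (- {0}) (- {0})"
    by (rule bij_betw_byWitness[where f' = "\<lambda>y. y / g"]) (use assms in auto)
  then have "(\<Sum>x\<in>-{0}. (g * x) ^ s / (g * x) ^ t) = (\<Sum>x\<in>-{0::'a}. x ^ s / x ^ t)"
    by (rule sum.reindex_bij_betw)
  then have "(g ^ s / g ^ t) * (\<Sum>x\<in>-{0}. x ^ s / x ^ t) = (\<Sum>x\<in>-{0::'a}. x ^ s / x ^ t)"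
    by (simp add: power_mult_distrib sum_distrib_left)
  moreover have "g ^ s / g ^ t \<noteq> 1"
    using assms by (simp add: divide_simps)
  ultimately show ?thesis
    by (simp only: mult_cancel_right2 simp_thms)
qed

text \<open>The exponents may exceed the order of the field, so \<open>g\<close> is chosen to
  separate \<open>s\<close> and \<open>t\<close>; the injective Frobenius power preserves the
  inequality.\<close>

lemma sum_frobenius_quotient_eq_0:
  assumes "CARD('a :: {field, finite}) = p ^ n" and "i \<le> n"
    and "0 < s" and "s < t" and "t < CARD('a)"
  shows "(\<Sum>x\<in>-{0::'a}. x ^ (s * p ^ i) / x ^ (t * p ^ i)) = 0"
    and "(\<Sum>x\<in>-{0::'a}. x ^ (t * p ^ i) / x ^ (s * p ^ i)) = 0"
proof -
  obtain g :: 'a where g: "g ^ s \<noteq> g ^ t"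
    using ex_power_neq assms by blast
  have inj: "x = y" if "x ^ (p ^ i) = y ^ (p ^ i)" for x y :: 'a
  proof -
    have "(z ^ p ^ i) ^ p ^ (n - i) = z" for z :: 'a
      using assms(1,2) finite_field_power_card[of z]
      by (simp flip: power_mult power_add)
    then show ?thesis
      using that by metis
  qed
  have "g \<noteq> 0"
    using g assms by (auto simp: power_0_left)
  moreover have "g ^ (s * p ^ i) \<noteq> g ^ (t * p ^ i)"
    using g inj by (auto simp: power_mult)
  ultimately show "(\<Sum>x\<in>-{0::'a}. x ^ (s * p ^ i) / x ^ (t * p ^ i)) = 0"
    and "(\<Sum>x\<in>-{0::'a}. x ^ (t * p ^ i) / x ^ (s * p ^ i)) = 0"
    using sum_power_quotient_eq_0[of g "s * p ^ i" "t * p ^ i"]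
      sum_power_quotient_eq_0[of g "t * p ^ i" "s * p ^ i"] by simp_all
qed

text \<open>The substitution \<open>z = x * y ^ r\<close> separates the variables.\<close>

lemma double_sum_twisted_product:
  fixes h :: "'a :: {field, finite} \<Rightarrow> 'a"
  shows "(\<Sum>x\<in>-{0}. \<Sum>y\<in>-{0}. h (x * y ^ r) / (x ^ a * y ^ b)) =
    (\<Sum>z\<in>-{0}. h z / z ^ a) * (\<Sum>y\<in>-{0}. y ^ (r * a) / y ^ b)"
proof -
  have "(\<Sum>x\<in>-{0}. h (x * y ^ r) / (x ^ a * y ^ b)) =
      (\<Sum>z\<in>-{0}. h z / z ^ a) * (y ^ (r * a) / y ^ b)" if "y \<noteq> 0" for y
  proof -
    have "bij_betw (\<lambda>x. x * y ^ r) (- {0}) (- {0})"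
      by (rule bij_betw_byWitness[where f' = "\<lambda>z. z / y ^ r"]) (use that in auto)
    then have "(\<Sum>x\<in>-{0}. h (x * y ^ r) / (x * y ^ r) ^ a) = (\<Sum>z\<in>-{0}. h z / z ^ a)"
      by (rule sum.reindex_bij_betw[where g = "\<lambda>z. h z / z ^ a"])
    moreover have "h (x * y ^ r) / (x ^ a * y ^ b) =
        h (x * y ^ r) / (x * y ^ r) ^ a * (y ^ (r * a) / y ^ b)" for x
      unfolding power_mult_distrib power_mult using that by simp
    ultimately show ?thesis
      unfolding sum_distrib_right[symmetric] by (simp only: sum_distrib_right[symmetric])
  qed
  then show ?thesis
    unfolding sum_distrib_left by (subst sum.swap) (intro sum.cong, simp_all)
qed

section \<open>Coefficients of additive maps and symmetric forms\<close>

lemma prime_field_linear_0: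
  "prime_field_linear f \<Longrightarrow> f 0 = 0"
  unfolding prime_field_linear_def by (metis add_cancel_right_right)

lemma prime_field_linear_sum:
  assumes "prime_field_linear f"
  shows "f (sum g A) = (\<Sum>x\<in>A. f (g x))"
proof -
  have "f (x + y) = f x + f y" for x y
    using assms by (simp add: prime_field_linear_def)
  then show ?thesis
    using prime_field_linear_0[OF assms]
    by (induction A rule: infinite_finite_induct) simp_all
qed

lemma sum_nonzero_one: "(\<Sum>x\<in>-{0 :: 'a :: {field, finite}}. 1) = (-1 :: 'a)"
proof -
  have "of_nat CARD('a) = (0 :: 'a)"
    using CHAR_dvd_CARD of_nat_eq_0_iff_char_dvd by blast
  moreover have "CARD('a) = Suc (card (- {0 :: 'a}))"
    by (metis Compl_eq_Diff_UNIV UNIV_I card.remove finite)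
  ultimately show ?thesis
    by (simp add: eq_neg_iff_add_eq_0 add.commute)
qed

text \<open>
  The sum below is minus the coefficient of \<open>X ^ (p ^ i)\<close> in the linearized polynomial of \<open>M\<close>.
  If all of them vanish, so does \<open>(\<Sum>x \<noteq> 0. T (y / x) * M x)\<close> for the absolute trace \<open>T\<close>;
  but \<open>T\<close> has values in the prime field, so this sum is \<open>M (\<Sum>x \<noteq> 0. T (y / x) * x) = M (- y)\<close>.
\<close>
lemma prime_field_linear_ex_coeff_neq_0:
  fixes M :: "'a :: {field, finite} \<Rightarrow> 'a"
  assumes "prime_field_linear M" and "M z \<noteq> 0"
    and p: "prime p" and card: "CARD('a) = p ^ n"
  shows "\<exists>i<n. (\<Sum>x\<in>-{0}. M x / x ^ (p ^ i)) \<noteq> 0"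
proof (rule ccontr)
  assume "\<not> ?thesis"
  then have coeff_0: "(\<Sum>x\<in>-{0}. M x / x ^ (p ^ i)) = 0" if "i < n" for i
    using that by blast
  have char: "CHAR('a) = p"
    using p card by (rule finite_field_CHAR)
  define T :: "'a \<Rightarrow> 'a" where "T x = (\<Sum>i<n. x ^ (p ^ i))" for x
  have "T x ^ p = T x" for x
  proof -
    \<comment> \<open>This closes the Frobenius cycle: raising to the power \<open>p\<close> only
      permutes the summands of \<open>T x\<close>.\<close>
    have "x ^ (p ^ n) = x ^ (p ^ 0)"
      using finite_field_power_card[of x] card by simp
    then have "(\<Sum>i<n. x ^ (p ^ Suc i)) = (\<Sum>i<n. x ^ (p ^ i))"
      using sum.lessThan_Suc_shift[of "\<lambda>i. x ^ (p ^ i)" n]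
        sum.lessThan_Suc[of "\<lambda>i. x ^ (p ^ i)" n] by simp
    then show ?thesis
      using p char by (simp add: T_def freshmans_dream_sum mult.commute flip: power_mult)
  qed
  then have T_prime: "T x \<in> range of_nat" for x
    using fixed_power_CHAR char by metis
  then have T_linear: "M (T x * w) = T x * M w" for x w
    using assms(1) unfolding prime_field_linear_def by blast
  \<comment> \<open>The sign offsets the -1 of \<open>sum_nonzero_one\<close>, which enters through
    the only surviving summand, \<open>i = 0\<close>.\<close>
  define y where "y = - z"
  have n: "n > 0"
    using card card_mono[of UNIV "{0, 1 :: 'a}"] by (cases n) simp_all
  have T_sum: "(\<Sum>x\<in>-{0}. T (y / x) * g x) =
      (\<Sum>i<n. y ^ (p ^ i) * (\<Sum>x\<in>-{0}. g x / x ^ (p ^ i)))" for g :: "'a \<Rightarrow> 'a"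
  proof -
    have "T (y / x) * g x = (\<Sum>i<n. y ^ (p ^ i) * (g x / x ^ (p ^ i)))" for x
      unfolding T_def sum_distrib_right power_divide by (rule sum.cong) simp_all
    then have "(\<Sum>x\<in>-{0}. T (y / x) * g x) =
        (\<Sum>x\<in>-{0}. \<Sum>i<n. y ^ (p ^ i) * (g x / x ^ (p ^ i)))"
      by simp
    also have "\<dots> = (\<Sum>i<n. \<Sum>x\<in>-{0}. y ^ (p ^ i) * (g x / x ^ (p ^ i)))"
      by (rule sum.swap)
    finally show ?thesis
      by (simp only: sum_distrib_left)
  qed
  have "(\<Sum>x\<in>-{0}. T (y / x) * x) = (\<Sum>i<n. y ^ (p ^ i) * (\<Sum>x\<in>-{0}. x / x ^ (p ^ i)))"
    by (rule T_sum)
  also have "\<dots> = (\<Sum>i<n. if i = 0 then - y else 0)"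
  proof (intro sum.cong refl)
    fix i assume i: "i \<in> {..<n}"
    show "y ^ (p ^ i) * (\<Sum>x\<in>-{0}. x / x ^ (p ^ i)) = (if i = 0 then - y else 0)"
    proof (cases "i = 0")
      case True
      have "(\<Sum>x\<in>-{0::'a}. x / x) = (\<Sum>x\<in>-{0::'a}. 1)"
        by (intro sum.cong) auto
      then show ?thesis
        using True sum_nonzero_one[where 'a = 'a] by simp
    next
      case False
      then have "1 < p ^ i" and "p ^ i < CARD('a)"
        using prime_gt_1_nat[OF p] i card one_less_power[of p i]
        by (simp_all add: power_strict_increasing)
      then show ?thesis
        using sum_frobenius_quotient_eq_0(1)[OF card, of 0 1 "p ^ i"] False by simp
    qed
  qed
  also have "\<dots> = z"
    using n by (simp add: y_def)
  finally have "M z = (\<Sum>x\<in>-{0}. M (T (y / x) * x))"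
    using prime_field_linear_sum[OF assms(1)] by metis
  also have "\<dots> = (\<Sum>x\<in>-{0}. T (y / x) * M x)"
    by (simp only: T_linear)
  also have "\<dots> = (\<Sum>i<n. y ^ (p ^ i) * (\<Sum>x\<in>-{0}. M x / x ^ (p ^ i)))"
    by (rule T_sum)
  also have "\<dots> = 0"
    by (simp add: coeff_0)
  finally show False
    using assms(2) by simp
qed

text \<open>Interchanging \<open>x\<close> and \<open>y\<close> gives the last term the shape of the
  middle one, with \<open>a\<close> and \<open>b\<close> swapped.\<close>

lemma double_sum_symmetric_form:
  fixes A H :: "'a :: {field, finite} \<Rightarrow> 'a"
  shows "(\<Sum>x\<in>-{0}. \<Sum>y\<in>-{0}. (A (x * y) + H (x * y ^ r) + H (x ^ r * y)) / (x ^ a * y ^ b)) =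
    (\<Sum>z\<in>-{0}. A z / z ^ a) * (\<Sum>y\<in>-{0}. y ^ a / y ^ b) +
    (\<Sum>z\<in>-{0}. H z / z ^ a) * (\<Sum>y\<in>-{0}. y ^ (r * a) / y ^ b) +
    (\<Sum>z\<in>-{0}. H z / z ^ b) * (\<Sum>y\<in>-{0}. y ^ (r * b) / y ^ a)"
proof -
  have "(\<Sum>x\<in>-{0}. \<Sum>y\<in>-{0}. H (x ^ r * y) / (x ^ a * y ^ b)) =
      (\<Sum>y\<in>-{0}. \<Sum>x\<in>-{0}. H (y * x ^ r) / (y ^ b * x ^ a))"
    by (subst sum.swap) (simp add: mult.commute)
  then show ?thesis
    using double_sum_twisted_product[of A 1 a b]
    by (simp add: add_divide_distrib sum.distrib double_sum_twisted_product)
qed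

theorem theorem5p2:
  fixes q l :: nat and \<omega> \<sigma> \<beta> :: "'a :: {field, finite}"
  assumes "primepow q" and "odd q" and "[int q = -1] (mod 4)"
    and "odd l" and "l > 1"
    and "CARD('a) = q ^ (2 * l)"
    and "\<omega> \<in> subfield_of_order (q ^ 2) - subfield_of_order q" and "\<omega> ^ q = - \<omega>"
    and "\<sigma> = \<omega> ^ 2"
    and "\<beta> \<in> subfield_of_order (q ^ 2)" and "\<beta> ^ (q + 1) = inverse \<sigma>"
  shows "\<not> strongly_isotopic (P_mult q l :: 'a \<Rightarrow> 'a \<Rightarrow> 'a) (B2_mult q l \<omega> \<beta>)"
proof
  assume "strongly_isotopic (P_mult q l :: 'a \<Rightarrow> 'a \<Rightarrow> 'a) (B2_mult q l \<omega> \<beta>)"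
  then obtain M L :: "'a \<Rightarrow> 'a" where M: "prime_field_linear M" "bij M" and L: "prime_field_linear L"
    and isotopism: "\<And>x y. B2_mult q l \<omega> \<beta> (M x) (M y) = L (P_mult q l x y)"
    unfolding strongly_isotopic_def by blast
  obtain p e where p: "prime p" and q: "q = p ^ e" and e: "e > 0"
    using assms(1) unfolding primepow_def by blast
  have card: "CARD('a) = p ^ (e * (2 * l))"
    using assms(6) q by (simp add: power_mult)
  have char: "CHAR('a) = p"
    using p card by (rule finite_field_CHAR)
  have q1: "1 < q"
    using prime_gt_1_nat[OF p] e q by (simp only: one_less_power)
  have l3: "3 \<le> l"
    using assms(4,5) by presburger
  have two: "(2 :: 'a) \<noteq> 0"
  proof -
    have "\<not> p dvd 2"
      using assms(2) q e p by (metis dvd_power primes_dvd_imp_eq two_is_prime_nat)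
    then show ?thesis
      using of_nat_eq_0_iff_char_dvd[of 2, where 'a = 'a] char by simp
  qed
  have frob_add: "(x + y) ^ (q ^ m) = x ^ (q ^ m) + y ^ (q ^ m)" for x y :: 'a and m
    using freshmans_dream'[of "q ^ m" "e * m" x y] p char q by (simp add: power_mult)
  have frob_minus: "(- x) ^ (q ^ m) = - (x ^ (q ^ m))" for x :: 'a and m
    using assms(2) by simp
  have frob_diff: "(x - y) ^ (q ^ m) = x ^ (q ^ m) - y ^ (q ^ m)" for x y :: 'a and m
    using frob_add[of x "- y" m] frob_minus by simp

  \<comment> \<open>The involution \<open>bar\<close> and the trace of the isotopism\<close>
  define bar :: "'a \<Rightarrow> 'a" where "bar x = x ^ (q ^ l)" for x
  have bar_add: "bar (x + y) = bar x + bar y" for x y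
    by (simp add: bar_def frob_add)
  have bar_mult: "bar (x * y) = bar x * bar y" for x y
    by (simp add: bar_def power_mult_distrib)
  have bar_divide: "bar (x / y) = bar x / bar y" for x y
    by (simp add: bar_def power_divide)
  have bar_power: "bar (x ^ m) = bar x ^ m" for x m
    by (simp add: bar_def mult.commute flip: power_mult)
  have bar_bar: "bar (bar x) = x" for x
    using finite_field_power_card[of x] assms(6)
    by (simp add: bar_def mult_2 power_add flip: power_mult)
  have bar_sum: "bar (sum g X) = (\<Sum>x\<in>X. bar (g x))" for g :: "'a \<Rightarrow> 'a" and X
    using freshmans_dream_sum'[of "q ^ l" "e * l" g X] p char q
    by (simp add: bar_def power_mult)
  have bar_0: "bar 0 = 0"
    using q1 by (simp add: bar_def power_0_left)
  have bar_eq_0: "bar x = 0 \<longleftrightarrow> x = 0" for x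
    using bar_0 bar_bar by metis
  have bar_minus: "bar (- x) = - bar x" for x
    by (simp add: bar_def frob_minus)
  have bar_1: "bar 1 = 1"
    by (simp add: bar_def)
  have bar_2: "bar 2 = 2"
    using bar_add[of 1 1] bar_1 by simp
  have bar_bij: "bij_betw bar (- {0}) (- {0})"
    by (rule bij_betw_byWitness[where f' = bar]) (auto simp: bar_bar bar_eq_0)
  have bar_\<omega>: "bar \<omega> = - \<omega>"
  proof -
    have "\<omega> ^ (q ^ m) = (if odd m then - \<omega> else \<omega>)" for m
    proof (induction m)
      case (Suc m)
      then show ?case
        using assms(8) frob_minus[of \<omega> 1]
        by (auto simp: power_mult mult.commute[of q] split: if_splits)
    qed simp
    then show ?thesis
      using assms(4) by (simp add: bar_def)
  qed
  have G_add: "G_fun q l (x + y) = G_fun q l x + G_fun q l y" for x y :: 'a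
  proof -
    have "(x + y - (x + y) ^ (q ^ l)) ^ (q ^ m) =
        (x - x ^ (q ^ l)) ^ (q ^ m) + (y - y ^ (q ^ l)) ^ (q ^ m)" for m
      by (simp add: frob_add frob_diff)
    then show ?thesis
      unfolding G_fun_def Let_def by (simp only: distrib_left sum.distrib) (simp add: algebra_simps)
  qed

  \<comment> \<open>The division by 2 lets the part of the product that \<open>bar\<close> fixes
    pass unchanged.\<close>
  define L1 where "L1 x = (L x + bar (L x)) / 2" for x
  have L1_add: "L1 (x + y) = L1 x + L1 y" for x y
    using L by (simp add: L1_def prime_field_linear_def bar_add add_divide_distrib algebra_simps)
  define A where "A x = L1 (1 / 2 * (x + bar x))" for x
  define H where "H x = L1 (1 / 4 * G_fun q l x)" for x
  have bar_A: "bar (A x) = A x" for x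
    by (simp add: A_def L1_def bar_divide bar_add bar_bar bar_2 add.commute)
  have A_bar: "A (bar x) = A x" for x
    by (simp add: A_def bar_bar add.commute)
  have L1_P: "L1 (P_mult q l x y) = A (x * y) + H (x * y ^ (q ^ 2)) + H (x ^ (q ^ 2) * y)" for x y
    unfolding P_mult_def A_def H_def
    by (simp add: L1_add G_add bar_mult distrib_left add.assoc flip: bar_def)

  \<comment> \<open>The trace to the subfield fixed by \<open>bar\<close> kills the \<open>\<omega>\<close>-component of the product.\<close>
  have form: "M x * bar (M y) + bar (M x) * M y =
      A (x * y) + H (x * y ^ (q ^ 2)) + H (x ^ (q ^ 2) * y)" for x y
  proof -
    define w where "w = M x * M y ^ (q ^ 2) + M x ^ (q ^ 2) * M y"
    have "L (P_mult q l x y) =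
        M x * bar (M y) + bar (M x) * M y + (\<beta> * w + bar \<beta> * bar w) * \<omega>"
      using isotopism[of x y] by (simp add: B2_mult_def w_def bar_def)
    then have "L1 (P_mult q l x y) = M x * bar (M y) + bar (M x) * M y"
      using two by (simp add: L1_def bar_add bar_mult bar_bar bar_\<omega> field_simps)
    then show ?thesis
      by (simp add: L1_P)
  qed

  \<comment> \<open>Comparison of coefficients\<close>
  have "\<exists>z. M z \<noteq> 0"
    using M(2) by (metis bij_pointE zero_neq_one)
  then obtain i where i: "i < e * (2 * l)" and coeff: "(\<Sum>x\<in>-{0}. M x / x ^ (p ^ i)) \<noteq> 0"
    using prime_field_linear_ex_coeff_neq_0[OF M(1) _ p card] by blast
  define a where "a = p ^ i"
  define U where "U = (\<Sum>x\<in>-{0}. M x / x ^ a)"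
  define V where "V = (\<Sum>x\<in>-{0}. bar (M x) / x ^ a)"
  have U: "U \<noteq> 0"
    using coeff by (simp add: U_def a_def)
  \<comment> \<open>\<open>bar\<close> moves the exponent \<open>a\<close> to
    \<open>q ^ l * a\<close>. Hence \<open>factor\<close> yields \<open>2 * (U * V)\<close> for
    \<open>b = a\<close>, and \<open>U * bar U + V * bar V\<close> for
    \<open>b = q ^ l * a\<close>.\<close>
  have bar_U: "bar U = (\<Sum>x\<in>-{0}. bar (M x) / x ^ (q ^ l * a))"
    by (simp add: U_def bar_sum bar_divide bar_power) (simp add: bar_def power_mult)
  have bar_V: "bar V = (\<Sum>x\<in>-{0}. M x / x ^ (q ^ l * a))"
    by (simp add: V_def bar_sum bar_divide bar_power bar_bar) (simp add: bar_def power_mult)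
  have factor: "(\<Sum>x\<in>-{0}. \<Sum>y\<in>-{0}.
        (A (x * y) + H (x * y ^ (q ^ 2)) + H (x ^ (q ^ 2) * y)) / (x ^ a * y ^ b)) =
      U * (\<Sum>y\<in>-{0}. bar (M y) / y ^ b) + V * (\<Sum>y\<in>-{0}. M y / y ^ b)" for b
    by (simp add: U_def V_def sum_product sum.distrib add_divide_distrib flip: form)
  have power_less: "q ^ m < CARD('a)" if "m < 2 * l" for m
    using that q1 assms(6) by (simp add: power_strict_increasing)
  have vanish: "(\<Sum>y\<in>-{0::'a}. y ^ (q ^ m * a) / y ^ (q ^ m' * a)) = 0"
    if "m < 2 * l" "m' < 2 * l" "m \<noteq> m'" for m m'
    using sum_frobenius_quotient_eq_0(1)[OF card, of i "q ^ m" "q ^ m'"]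
      sum_frobenius_quotient_eq_0(2)[OF card, of i "q ^ m'" "q ^ m"]
      i q1 that power_less[of m] power_less[of m'] unfolding a_def
    by (cases m m' rule: linorder_cases) simp_all

  \<comment> \<open>Only the term with \<open>A\<close> survives, its second factor being a sum of
    ones, that is, -1.\<close>
  have diag: "2 * (U * V) = - (\<Sum>z\<in>-{0}. A z / z ^ a)"
  proof -
    have "(\<Sum>y\<in>-{0::'a}. y ^ a / y ^ a) = (\<Sum>y\<in>-{0::'a}. 1)"
      by (intro sum.cong) auto
    then have "(\<Sum>y\<in>-{0::'a}. y ^ a / y ^ a) = -1"
      by (simp only: sum_nonzero_one)
    moreover have "(\<Sum>y\<in>-{0::'a}. y ^ (q ^ 2 * a) / y ^ a) = 0"
      using vanish[of 2 0] l3 by simp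
    ultimately show ?thesis
      using factor[of a] unfolding double_sum_symmetric_form
      by (simp flip: U_def V_def)
  qed
  \<comment> \<open>Up to the factor \<open>a\<close>, the exponents compared are 1 and
    \<open>q ^ l\<close>, \<open>q ^ 2\<close> and \<open>q ^ l\<close>, \<open>q ^ (2 + l)\<close>
    and 1. As \<open>l\<close> is at least 3, \<open>vanish\<close> covers all three pairs.\<close>
  have off_diag: "U * bar U + V * bar V = 0"
  proof -
    have "(\<Sum>y\<in>-{0::'a}. y ^ a / y ^ (q ^ l * a)) = 0"
      using vanish[of 0 l] l3 by simp
    moreover have "(\<Sum>y\<in>-{0::'a}. y ^ (q ^ 2 * a) / y ^ (q ^ l * a)) = 0"
      using vanish[of 2 l] l3 by simp
    moreover have "(\<Sum>y\<in>-{0::'a}. y ^ (q ^ 2 * (q ^ l * a)) / y ^ a) = 0"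
      using vanish[of "2 + l" 0] l3 by (simp add: power2_eq_square mult.assoc)
    ultimately show ?thesis
      using factor[of "q ^ l * a"] unfolding double_sum_symmetric_form
      by (simp flip: bar_U bar_V)
  qed
  \<comment> \<open>Since \<open>A\<close> is invariant under \<open>bar\<close> on both sides,
    \<open>bar\<close> only permutes the summands.\<close>
  have "bar (\<Sum>z\<in>-{0}. A z / z ^ a) = (\<Sum>z\<in>-{0}. A (bar z) / bar z ^ a)"
    by (simp add: bar_sum bar_divide bar_power bar_A A_bar)
  also have "\<dots> = (\<Sum>z\<in>-{0}. A z / z ^ a)"
    using bar_bij by (rule sum.reindex_bij_betw)
  finally have "bar (2 * (U * V)) = 2 * (U * V)"
    unfolding diag by (simp add: bar_minus)
  then have fixed: "bar U * bar V = U * V"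
    using two by (simp add: bar_mult bar_2)

  \<comment> \<open>Numerator and denominator are both fixed by \<open>bar\<close>, so
    \<open>j\<close> is a square root of -1 in the field of order \<open>q ^ l\<close>.\<close>
  define j where "j = U * V / (U * bar U)"
  have bar_j: "bar j = j"
    using U fixed by (simp add: j_def bar_mult bar_divide bar_bar bar_eq_0 field_simps)
  have "(U * V) ^ 2 = (U * bar U) * (V * bar V)"
    using fixed by (simp add: power2_eq_square algebra_simps)
  also have "\<dots> = - ((U * bar U) ^ 2)"
    using off_diag by (simp add: add_eq_0_iff power2_eq_square)
  finally have square: "(U * V) ^ 2 = - ((U * bar U) ^ 2)" .
  have j2: "j ^ 2 = -1"
    unfolding j_def power_divide square using U by (simp add: bar_eq_0)
  have "q mod 4 = 3"
    using assms(3) by (simp add: cong_def) presburger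
  then have "q ^ l mod 4 = 3"
  proof -
    have "q ^ l mod 4 = 3 ^ l mod 4"
      using \<open>q mod 4 = 3\<close> by (metis power_mod)
    moreover obtain k where "l = 2 * k + 1"
      using assms(4) by (rule oddE)
    moreover have "(3::nat) ^ (2 * k + 1) mod 4 = 3" for k
      by (induction k) (simp_all, presburger)
    ultimately show ?thesis
      by simp
  qed
  then obtain m where "q ^ l = 4 * m + 3"
    by (metis mult_div_mod_eq)
  \<comment> \<open>The odd factor \<open>2 * m + 1\<close> makes \<open>bar j = - j\<close>,
    against \<open>bar j = j\<close>.\<close>
  then have "q ^ l = Suc (2 * (2 * m + 1))"
    by simp
  then have "bar j = (j ^ 2) ^ (2 * m + 1) * j"
    by (simp only: bar_def power_Suc2 power_mult)
  then have "2 * j = 0"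
    using bar_j j2 by (simp add: eq_neg_iff_add_eq_0)
  then show False
    using two j2 by simp
qed

end
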